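(* For every $\lambda\in(0,1)$ there exist a non-empty compact metric space $(X,d)$ and continuous functions $f,g:X\to X$ such that for all $x,y\in X$ either $d(f(x),f(y))\le\lambda d(x,y)$ or $d(g(x),g(y))\le\lambda d(x,y)$ holds, but no word in $f,g$ has a fixed point.
   Context: A word in $f,g$ is a composition $h_1\circ h_2\circ\dots\circ h_m$ with $m\ge 1$ and each $h_i\in\{f,g\}$. *)

theory Defs
  imports "HOL-Analysis.Analysis"
begin

definition is_word :: "('a \<Rightarrow> 'a) \<Rightarrow> ('a \<Rightarrow> 'a) \<Rightarrow> ('a \<Rightarrow> 'a) \<Rightarrow> bool" where
  "is_word f g w \<longleftrightarrow>
     (\<exists>hs. hs \<noteq> [] \<and> set hs \<subseteq> {f, g} \<and> w = foldr (\<circ>) hs id)"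

(* A compact metric space has at most the cardinality of the continuum, so it is isometric
   to one whose points are real numbers, with a metric unrelated to the usual distance.
   Hence quantifying existentially over "real metric" loses no compact metric space. *)

end

theory Submission
  imports Defs
begin

text \<open>
  The space consists of the sequences of natural numbers \<open>x\<close> with \<open>x n \<le> n + 1\<close>, and the
  distance of two of them is \<open>lam ^ n\<close> for the first index \<open>n\<close> at which they differ. To every index
  \<open>n\<close> belongs a question \<open>ask n\<close> with a yes/no answer that depends only on the entries of a sequence
  before \<open>n\<close>. Let \<open>f\<close> be the map for the answer yes and \<open>g\<close> the map for the answer no. At each index
  the map that matches the answer resets the entry to \<open>0\<close>, whereas the other one increments the
  entry, cyclically within \<open>1, \<dots>, n + 1\<close>.

  Contraction: if \<open>x\<close> and \<open>y\<close> first differ at \<open>n\<close>, then they give the same answer at \<open>n\<close>, and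
  the map that matches it resets both entries at \<open>n\<close>. So the images first differ after \<open>n\<close>.

  No fixed points: the questions are so rich that on finitely many distinct points any
  prescribed answers are realised at arbitrarily large indices (\<open>ask_generic\<close>). Two consequences
  exclude periodic orbits. A common value of two different (point, map) pairs is impossible, because
  at some index the first map resets and the second increments, and only resetting produces \<open>0\<close>
  (\<open>step_eq_iff\<close>). Hence a periodic orbit can be traced backwards, and so, going once around, the
  map applied at a time is determined by the point visited at that time. Therefore there are
  answers on the points of the orbit that are always opposite to the map applied next. At a large
  index with these answers the whole word only increments, and the entry at that index cannot
  return to its initial value, as the cycle is longer than the word.
\<close>

section \<open>The two maps on sequences\<close>

text \<open>
  The number \<open>n\<close> is decoded as a finite list of finite words, and the question is whether one of
  them is an initial segment of the sequence. The second component of the decoded pair is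
  a dummy that makes every list of words occur at infinitely many indices.
\<close>
definition ask :: "nat \<Rightarrow> (nat \<Rightarrow> nat) \<Rightarrow> bool" where
  "ask n x \<longleftrightarrow> (\<exists>l \<in> set (fst (from_nat n :: nat list list \<times> nat)).
     length l \<le> n \<and> map x [0..<length l] = l)"

text \<open>
  Incrementing wraps around to \<open>1\<close> and not to \<open>0\<close>, so that an entry \<open>0\<close> reveals a reset.
\<close>
definition step :: "bool \<Rightarrow> (nat \<Rightarrow> nat) \<Rightarrow> nat \<Rightarrow> nat" where
  "step b x n = (if ask n x = b then 0 else 1 + x n mod (n + 1))"

definition Seqs :: "(nat \<Rightarrow> nat) set" where
  "Seqs = {x. \<forall>n. x n \<le> n + 1}"

lemma step_in_Seqs: "step b x \<in> Seqs"
  by (auto simp: Seqs_def step_def intro: less_imp_le)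

lemma ask_cong:
  assumes "\<And>i. i < n \<Longrightarrow> x i = y i"
  shows "ask n x = ask n y"
proof -
  have "map x [0..<length l] = map y [0..<length l]" if "length l \<le> n" for l :: "nat list"
    using assms that by simp
  then show ?thesis
    unfolding ask_def by metis
qed

lemma step_cong:
  assumes "\<And>i. i < N \<Longrightarrow> x i = y i" and "i < N"
  shows "step b x i = step b y i"
proof -
  have "ask i x = ask i y"
    using assms by (intro ask_cong) auto
  then show ?thesis
    using assms by (simp add: step_def)
qed

lemma step_contracts_first_difference:
  assumes "\<And>i. i < n \<Longrightarrow> x i = y i" and "i \<le> n"
  shows "step (ask n x) x i = step (ask n x) y i"
proof (cases "i = n")
  case True
  then show ?thesis
    using ask_cong[OF assms(1)] by (simp add: step_def)
next
  case False
  then show ?thesis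
    using step_cong[OF assms(1)] assms(2) by simp
qed

lemma finite_separating_prefix:
  fixes A :: "(nat \<Rightarrow> 'a) set"
  assumes "finite A"
  obtains m where "inj_on (\<lambda>x. map x [0..<m]) A"
proof -
  define e where "e = (\<lambda>(x :: nat \<Rightarrow> 'a, y). LEAST i. x i \<noteq> y i)"
  have e: "x (e (x, y)) \<noteq> y (e (x, y))" if "x \<noteq> y" for x y
  proof -
    have "\<exists>i. x i \<noteq> y i"
      using that by auto
    from LeastI_ex[OF this] show ?thesis
      by (simp add: e_def)
  qed
  define m where "m = Suc (Max (e ` (A \<times> A)))"
  have "inj_on (\<lambda>x. map x [0..<m]) A"
  proof (rule inj_onI, rule ccontr)
    fix x y assume "x \<in> A" "y \<in> A" and eq: "map x [0..<m] = map y [0..<m]" and "x \<noteq> y"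
    then have "e (x, y) < m"
      unfolding m_def less_Suc_eq_le using assms by (intro Max_ge) auto
    then have "x (e (x, y)) = y (e (x, y))"
      using eq by (auto simp: map_eq_conv)
    then show False
      using e[OF \<open>x \<noteq> y\<close>] by simp
  qed
  then show thesis by (rule that)
qed

text \<open>
  List the initial segments of the points that are to answer yes, taken long enough to
  tell the given points apart, and let the dummy component run until the code is large.
\<close>
lemma ask_generic:
  assumes "finite A"
  obtains n where "N \<le> n" and "\<And>x. x \<in> A \<Longrightarrow> ask n x = \<gamma> x"
proof -
  obtain m where m: "inj_on (\<lambda>x. map x [0..<m]) A"
    using finite_separating_prefix[OF assms] .
  obtain S where S: "set S = (\<lambda>x. map x [0..<m]) ` {x \<in> A. \<gamma> x}"
    using finite_list[of "(\<lambda>x. map x [0..<m]) ` {x \<in> A. \<gamma> x}"] assms by auto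
  have "inj (\<lambda>j::nat. to_nat (S, j))"
    by (auto intro!: injI)
  then have "infinite (range (\<lambda>j::nat. to_nat (S, j)))"
    by (simp add: finite_image_iff)
  then obtain j :: nat where j: "max N m \<le> to_nat (S, j)"
    unfolding infinite_nat_iff_unbounded_le by blast
  let ?n = "to_nat (S, j)"
  have "ask ?n x = \<gamma> x" if "x \<in> A" for x
  proof -
    have "ask ?n x \<longleftrightarrow> (\<exists>y \<in> A. \<gamma> y \<and> map x [0..<m] = map y [0..<m])"
      unfolding ask_def using j S by auto
    also have "\<dots> \<longleftrightarrow> \<gamma> x"
      using inj_onD[OF m] that by blast
    finally show ?thesis .
  qed
  then show thesis
    using that j by auto
qed

section \<open>No word fixes a sequence\<close>

text \<open>
  For different pairs, some index has the answer \<open>b\<close> at \<open>x\<close> and the answer opposite to \<open>b'\<close>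
  at \<open>y\<close>. There the entry of the first image is \<open>0\<close> and that of the second is not.
\<close>
lemma step_eq_iff: "step b x = step b' y \<longleftrightarrow> b = b' \<and> x = y"
proof
  assume eq: "step b x = step b' y"
  show "b = b' \<and> x = y"
  proof (rule ccontr)
    assume ne: "\<not> (b = b' \<and> x = y)"
    obtain n where n: "\<And>z. z \<in> {x, y} \<Longrightarrow> ask n z = (if z = x then b else \<not> b')"
      using ask_generic[of "{x, y}" 0 "\<lambda>z. if z = x then b else \<not> b'"] by auto
    have "ask n x = b" "ask n y \<noteq> b'"
      using n ne by (auto split: if_splits)
    then have "step b x n \<noteq> step b' y n"
      by (simp add: step_def)
    with eq show False by simp
  qed
qed simp

text \<open>
  The sequence \<open>h\<close> of maps has to have period \<open>L\<close> as well: injectivity of \<open>step\<close> compares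
  only earlier times, and periodicity turns the time \<open>L\<close> steps before \<open>i + L\<close> into \<open>i\<close> itself,
  which gives that equal points of the orbit are left by equal maps.
\<close>
lemma step_orbit_not_periodic:
  assumes step: "\<And>i. s (Suc i) = step (h i) (s i)"
    and per: "\<And>i. h (i + L) = h i" and L: "0 < L"
  shows "s L \<noteq> s 0"
proof
  assume "s L = s 0"
  then have s_per: "s (i + L) = s i" for i
    by (induction i) (simp_all add: step per)
  have retrace: "s i = s j \<and> (\<forall>k<t. h (i + k) = h (j + k))" if "s (i + t) = s (j + t)" for i j t
    using that
  proof (induction t)
    case (Suc t)
    then have "h (i + t) = h (j + t)" "s (i + t) = s (j + t)"
      by (simp_all add: step step_eq_iff)
    then show ?case
      using Suc.IH by (simp add: less_Suc_eq)
  qed simp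
  have det: "h i = h j" if "s i = s j" for i j
    using retrace[of i L j] that L by (auto simp: s_per)
  \<comment> \<open>By \<open>det\<close>, these answers make every step of the orbit an incrementing one.\<close>
  obtain n where n: "L \<le> n" "\<And>x. x \<in> s ` {..<L} \<Longrightarrow> ask n x = (\<exists>i. s i = x \<and> \<not> h i)"
    using ask_generic[of "s ` {..<L}" L "\<lambda>x. \<exists>i. s i = x \<and> \<not> h i"] by auto
  have "s (Suc i) n = 1 + s i n mod (n + 1)" if "i < L" for i
  proof -
    have "ask n (s i) \<noteq> h i"
    proof -
      have "ask n (s i) \<longleftrightarrow> (\<exists>j. s j = s i \<and> \<not> h j)"
        using that by (intro n(2)) simp
      also have "\<dots> \<longleftrightarrow> \<not> h i"
        using det by blast
      finally show ?thesis by simp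
    qed
    then show ?thesis
      by (simp add: step step_def)
  qed
  then have "i \<le> L \<Longrightarrow> s i n mod (n + 1) = (s 0 n + i) mod (n + 1)" for i
  proof (induction i)
    case (Suc i)
    then have "s (Suc i) n mod (n + 1) = (1 + (s 0 n + i) mod (n + 1)) mod (n + 1)"
      by simp
    also have "\<dots> = (s 0 n + Suc i) mod (n + 1)"
      by (simp only: plus_1_eq_Suc mod_Suc_eq add_Suc_right)
    finally show ?case .
  qed simp
  from this[of L] have "(s 0 n + L) mod (n + 1) = s 0 n mod (n + 1)"
    using \<open>s L = s 0\<close> by simp
  then have "n + 1 dvd L"
    using mod_eq_dvd_iff_nat[of "s 0 n" "s 0 n + L" "n + 1"] by (simp only: le_add1 diff_add_inverse)
  with L n(1) show False
    by (auto dest: dvd_imp_le)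
qed

lemma foldr_step_neq:
  assumes "bs \<noteq> []"
  shows "foldr step bs x \<noteq> x"
proof -
  let ?L = "length bs"
  define h where "h i = rev bs ! (i mod ?L)" for i
  define s where "s = rec_nat x (\<lambda>i. step (h i))"
  have s: "s 0 = x" "s (Suc i) = step (h i) (s i)" for i
    by (simp_all add: s_def)
  have "i \<le> ?L \<Longrightarrow> fold step (take i (rev bs)) x = s i" for i
  proof (induction i)
    case (Suc i)
    then show ?case
      by (simp add: take_Suc_conv_app_nth s h_def)
  qed (simp add: s)
  from this[of ?L] have "foldr step bs x = s ?L"
    by (simp add: foldr_conv_fold)
  moreover have "s ?L \<noteq> s 0"
  proof (rule step_orbit_not_periodic)
    show "s (Suc i) = step (h i) (s i)" for i
      by (rule s(2))
    show "h (i + ?L) = h i" for i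
      by (simp add: h_def)
    show "0 < ?L"
      using assms by simp
  qed
  ultimately show ?thesis
    by (simp add: s)
qed

section \<open>The first-difference metric\<close>

definition seq_dist :: "real \<Rightarrow> (nat \<Rightarrow> nat) \<Rightarrow> (nat \<Rightarrow> nat) \<Rightarrow> real" where
  "seq_dist lam x y = (if x = y then 0 else lam ^ (LEAST n. x n \<noteq> y n))"

lemma seq_dist_eq_power:
  assumes "x \<noteq> y"
  shows "\<exists>n. x n \<noteq> y n \<and> (\<forall>i<n. x i = y i) \<and> seq_dist lam x y = lam ^ n"
proof (intro exI conjI allI impI)
  have "\<exists>n. x n \<noteq> y n"
    using assms by auto
  then show "x (LEAST n. x n \<noteq> y n) \<noteq> y (LEAST n. x n \<noteq> y n)"
    by (rule LeastI_ex)
  show "x i = y i" if "i < (LEAST n. x n \<noteq> y n)" for i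
    using not_less_Least[OF that] by simp
  show "seq_dist lam x y = lam ^ (LEAST n. x n \<noteq> y n)"
    using assms by (simp add: seq_dist_def)
qed

context
  fixes lam :: real
  assumes lam: "0 < lam" "lam < 1"
begin

lemma seq_dist_le_power_iff: "seq_dist lam x y \<le> lam ^ N \<longleftrightarrow> (\<forall>i<N. x i = y i)"
proof (cases "x = y")
  case True
  then show ?thesis
    using lam by (simp add: seq_dist_def)
next
  case False
  obtain n where n: "x n \<noteq> y n" "\<And>i. i < n \<Longrightarrow> x i = y i" "seq_dist lam x y = lam ^ n"
    using seq_dist_eq_power[OF False, of lam] by blast
  have "lam ^ n \<le> lam ^ N \<longleftrightarrow> N \<le> n"
    using lam by simp
  also have "\<dots> \<longleftrightarrow> (\<forall>i<N. x i = y i)"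
    using n(1,2) by (metis leI less_le_trans)
  finally show ?thesis
    by (simp add: n(3))
qed

lemma seq_dist_nonneg: "0 \<le> seq_dist lam x y"
  using lam by (simp add: seq_dist_def)

lemma seq_dist_eq_0_iff: "seq_dist lam x y = 0 \<longleftrightarrow> x = y"
  using lam by (simp add: seq_dist_def)

lemma seq_dist_commute: "seq_dist lam x y = seq_dist lam y x"
  by (simp add: seq_dist_def eq_commute)

text \<open>
  If both distances on the right were below \<open>lam ^ n\<close>, with \<open>n\<close> the first index at which \<open>x\<close> and
  \<open>z\<close> differ, then \<open>x\<close>, \<open>y\<close> and \<open>z\<close> would agree at \<open>n\<close>.
\<close>
lemma seq_dist_triangle: "seq_dist lam x z \<le> seq_dist lam x y + seq_dist lam y z"
proof (cases "x = z")
  case True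
  then show ?thesis
    using seq_dist_nonneg by (simp add: seq_dist_eq_0_iff[THEN iffD2])
next
  case False
  obtain n where n: "x n \<noteq> z n" "\<And>i. i < n \<Longrightarrow> x i = z i" "seq_dist lam x z = lam ^ n"
    using seq_dist_eq_power[OF False, of lam] by blast
  show ?thesis
  proof (rule ccontr)
    assume "\<not> ?thesis"
    then have lt: "seq_dist lam x y < lam ^ n" "seq_dist lam y z < lam ^ n"
      using n(3) seq_dist_nonneg[of x y] seq_dist_nonneg[of y z] by linarith+
    have agree: "u n = v n" if small: "seq_dist lam u v < lam ^ n" for u v
    proof (cases "u = v")
      case False
      obtain k where k: "u k \<noteq> v k" "\<And>i. i < k \<Longrightarrow> u i = v i" "seq_dist lam u v = lam ^ k"
        using seq_dist_eq_power[OF False, of lam] by blast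
      then have "n < k"
        using small lam by simp
      then show ?thesis by (rule k(2))
    qed simp
    show False
      using agree[OF lt(1)] agree[OF lt(2)] n(1) by simp
  qed
qed

lemma seq_dist_step_le: "seq_dist lam (step b x) (step b y) \<le> seq_dist lam x y"
proof (cases "x = y")
  case False
  obtain n where n: "x n \<noteq> y n" "\<And>i. i < n \<Longrightarrow> x i = y i" "seq_dist lam x y = lam ^ n"
    using seq_dist_eq_power[OF False, of lam] by blast
  then show ?thesis
    using step_cong[of n x y] by (simp add: seq_dist_le_power_iff)
qed (simp add: seq_dist_def)

lemma seq_dist_step_contracts:
  "\<exists>b. seq_dist lam (step b x) (step b y) \<le> lam * seq_dist lam x y"
proof (cases "x = y")
  case False
  obtain n where n: "x n \<noteq> y n" "\<And>i. i < n \<Longrightarrow> x i = y i" "seq_dist lam x y = lam ^ n"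
    using seq_dist_eq_power[OF False, of lam] by blast
  have "seq_dist lam (step (ask n x) x) (step (ask n x) y) \<le> lam ^ Suc n"
    unfolding seq_dist_le_power_iff
    using step_contracts_first_difference[OF n(2)] by (simp add: less_Suc_eq_le)
  then show ?thesis
    by (auto simp: n(3))
qed (simp add: seq_dist_def)

section \<open>The space as a set of real numbers\<close>

context
  fixes code :: "(nat \<Rightarrow> nat) \<Rightarrow> real"
  assumes inj_code: "inj code"
begin

definition code_dist :: "real \<Rightarrow> real \<Rightarrow> real" where
  "code_dist a b = seq_dist lam (inv code a) (inv code b)"

lemma code_dist_code: "code_dist (code x) (code y) = seq_dist lam x y"
  by (simp add: code_dist_def inj_code)

lemma Metric_space_code: "Metric_space (code ` Seqs) code_dist"
proof
  show "code_dist a b = 0 \<longleftrightarrow> a = b" if "a \<in> code ` Seqs" "b \<in> code ` Seqs" for a b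
    using that by (auto simp: code_dist_code seq_dist_eq_0_iff)
qed (auto simp: code_dist_def seq_dist_nonneg seq_dist_commute seq_dist_triangle)

definition code_metric :: "real metric" where
  "code_metric = metric (code ` Seqs, code_dist)"

lemma mspace_code_metric: "mspace code_metric = code ` Seqs"
  by (simp add: code_metric_def Metric_space.mspace_metric[OF Metric_space_code])

lemma mdist_code_metric: "mdist code_metric = code_dist"
  by (simp add: code_metric_def Metric_space.mdist_metric[OF Metric_space_code])

text \<open>
  The space is a continuous image of a product of finite discrete spaces, since a ball
  contains all sequences that agree with its centre up to some index.
\<close>
lemma compact_code_metric: "compact_space (mtopology_of code_metric)"
proof -
  interpret Metric_space "code ` Seqs" code_dist
    by (rule Metric_space_code)
  define P where "P = product_topology (\<lambda>n. discrete_topology {..n + 1}) (UNIV :: nat set)"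
  have P: "topspace P = Seqs"
    by (auto simp: P_def Seqs_def PiE_UNIV_domain)
  have "compact_space P"
    by (simp add: P_def compact_space_product_topology compact_space_discrete_topology)
  moreover have "continuous_map P mtopology code"
    unfolding continuous_map_to_metric P
  proof (intro ballI allI impI)
    fix x and \<epsilon> :: real
    assume x: "x \<in> Seqs" and "0 < \<epsilon>"
    obtain N where N: "lam ^ N < \<epsilon>"
      using real_arch_pow_inv[OF \<open>0 < \<epsilon>\<close> lam(2)] by blast
    define U where "U = PiE UNIV (\<lambda>n. if n < N then {x n} else {..n + 1})"
    have "openin P U"
      unfolding P_def U_def openin_PiE_gen
    proof (intro disjI2 conjI ballI)
      have "{n \<in> UNIV. \<not> (if n < N then {x n} else {..n + 1})
              = topspace (discrete_topology {..n + 1})} \<subseteq> {..<N}"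
        by auto
      then show "finite {n \<in> UNIV. (if n < N then {x n} else {..n + 1})
              \<noteq> topspace (discrete_topology {..n + 1})}"
        by (rule finite_subset) simp
    qed (use x in \<open>auto simp: Seqs_def\<close>)
    moreover have "x \<in> U"
      using x by (auto simp: U_def Seqs_def)
    moreover have "code y \<in> mball (code x) \<epsilon>" if "y \<in> U" for y
    proof -
      have y: "y n \<in> (if n < N then {x n} else {..n + 1})" for n
        using that unfolding U_def by (rule PiE_mem) simp
      have "\<forall>i<N. x i = y i"
        using y by (metis singletonD)
      moreover have "y \<in> Seqs"
        unfolding Seqs_def
      proof (intro CollectI allI)
        fix n show "y n \<le> n + 1"
          using y[of n] x by (auto simp: Seqs_def split: if_splits)
      qed
      ultimately show ?thesis
        using x N seq_dist_le_power_iff[of x y N] by (simp add: in_mball code_dist_code)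
    qed
    ultimately show "\<exists>U. openin P U \<and> x \<in> U \<and> (\<forall>y\<in>U. code y \<in> mball (code x) \<epsilon>)"
      by blast
  qed
  ultimately have "compactin mtopology (code ` topspace P)"
    unfolding compact_space_def by (rule image_compactin)
  then show ?thesis
    by (simp add: compact_space_def P code_metric_def)
qed

definition code_step :: "bool \<Rightarrow> real \<Rightarrow> real" where
  "code_step b a = code (step b (inv code a))"

lemma code_step_code: "code_step b (code x) = code (step b x)"
  by (simp add: code_step_def inj_code)

lemma continuous_code_step:
  "continuous_map (mtopology_of code_metric) (mtopology_of code_metric) (code_step b)"
proof (rule Lipschitz_continuous_imp_continuous_map)
  show "Lipschitz_continuous_map code_metric code_metric (code_step b)"
    unfolding Lipschitz_continuous_map_def mspace_code_metric mdist_code_metric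
    by (intro conjI exI[of _ 1])
      (auto simp: code_step_code code_dist_code step_in_Seqs seq_dist_step_le)
qed

lemma code_step_contracts:
  assumes "a \<in> mspace code_metric" "b \<in> mspace code_metric"
  shows "\<exists>c. mdist code_metric (code_step c a) (code_step c b) \<le> lam * mdist code_metric a b"
  using assms seq_dist_step_contracts
  by (auto simp: mspace_code_metric mdist_code_metric code_step_code code_dist_code)

lemma word_code_step_neq:
  assumes "is_word (code_step True) (code_step False) w" and "a \<in> mspace code_metric"
  shows "w a \<noteq> a"
proof -
  have "{code_step True, code_step False} \<subseteq> range code_step"
    by blast
  then obtain hs where hs: "hs \<noteq> []" "set hs \<subseteq> range code_step" "w = foldr (\<circ>) hs id"
    using assms(1) unfolding is_word_def by blast
  then obtain bs where bs: "hs = map code_step bs"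
    by (metis ex_map_conv rangeE subsetD)
  obtain x where x: "a = code x"
    using assms(2) by (auto simp: mspace_code_metric)
  have "foldr (\<circ>) (map code_step bs) id (code x) = code (foldr step bs x)"
    by (induction bs) (simp_all add: code_step_code)
  then show ?thesis
    using hs bs foldr_step_neq[of bs x] inj_eq[OF inj_code] x by simp
qed

end

end

text \<open>A sequence is determined by its graph, which is in effect a set of natural numbers.\<close>
lemma ex_inj_nat_fun_real: "\<exists>code :: (nat \<Rightarrow> nat) \<Rightarrow> real. inj code"
proof -
  obtain e :: "nat set \<Rightarrow> real" where e: "inj e"
    using nat_sets_eqpoll_reals unfolding eqpoll_def by (auto simp: bij_betw_def)
  have "inj (\<lambda>x :: nat \<Rightarrow> nat. e (range (\<lambda>i. to_nat (i, x i))))"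
  proof (rule injI)
    fix x y :: "nat \<Rightarrow> nat"
    assume "e (range (\<lambda>i. to_nat (i, x i))) = e (range (\<lambda>i. to_nat (i, y i)))"
    then have eq: "range (\<lambda>i. to_nat (i, x i)) = range (\<lambda>i. to_nat (i, y i))"
      by (rule injD[OF e])
    have "x i = y i" for i
    proof -
      have "to_nat (i, x i) \<in> range (\<lambda>i. to_nat (i, y i))"
        unfolding eq[symmetric] by simp
      then show ?thesis
        by auto
    qed
    then show "x = y" ..
  qed
  then show ?thesis
    by (rule exI[where P = "\<lambda>code. inj code"])
qed

theorem mainTheorem2:
  fixes lam :: real
  assumes "0 < lam" and "lam < 1"
  shows "\<exists>(M :: real metric) f g.
           mspace M \<noteq> {} \<and> compact_space (mtopology_of M) \<and>
           continuous_map (mtopology_of M) (mtopology_of M) f \<and>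
           continuous_map (mtopology_of M) (mtopology_of M) g \<and>
           (\<forall>x\<in>mspace M. \<forall>y\<in>mspace M.
              mdist M (f x) (f y) \<le> lam * mdist M x y \<or>
              mdist M (g x) (g y) \<le> lam * mdist M x y) \<and>
           (\<forall>w. is_word f g w \<longrightarrow> \<not> (\<exists>x\<in>mspace M. w x = x))"
proof -
  obtain code :: "(nat \<Rightarrow> nat) \<Rightarrow> real" where code: "inj code"
    using ex_inj_nat_fun_real by blast
  note facts = assms code
  show ?thesis
  proof (intro exI conjI ballI allI impI)
    let ?M = "code_metric lam code"
    let ?f = "code_step code True"
    let ?g = "code_step code False"
    show "mspace ?M \<noteq> {}"
      using step_in_Seqs by (auto simp: mspace_code_metric[OF facts])
    show "compact_space (mtopology_of ?M)"
      by (rule compact_code_metric[OF facts])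
    show "continuous_map (mtopology_of ?M) (mtopology_of ?M) ?f"
      "continuous_map (mtopology_of ?M) (mtopology_of ?M) ?g"
      by (rule continuous_code_step[OF facts])+
    show "mdist ?M (?f x) (?f y) \<le> lam * mdist ?M x y \<or> mdist ?M (?g x) (?g y) \<le> lam * mdist ?M x y"
      if "x \<in> mspace ?M" "y \<in> mspace ?M" for x y
      using code_step_contracts[OF facts that] by (metis (full_types))
    show "\<not> (\<exists>x\<in>mspace ?M. w x = x)" if "is_word ?f ?g w" for w
      using word_code_step_neq[OF facts that] by blast
  qed
qed

end
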